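(* Let $(D,G_o)$ be a two-sender unicast index-coding problem with a fully participated interaction between its sub-digraphs $D_1,D_2,D_3$. Suppose that $f(D)$ contains both arcs $(1,3)$ and $(3,1)$ and contains at most one of the arcs $(2,3)$, $(3,2)$ (with arbitrary arcs between $1$ and $2$). Then, for every $t\ge1$: (i) $\beta_t(D,G_o)\le\beta_t(D_2)+\max\{\beta_t(D_1),\beta_t(D_3)\}$; (ii) $\beta_t(D,G_o)=\beta_t(D_1)+\beta_t(D_2)$ if $\beta_t(D_1)\ge\beta_t(D_3)$; (iii) $\beta(D,G_o)\le\beta(D_2)+\max\{\beta(D_1),\beta(D_3)\}$; (iv) $\beta(D,G_o)=\beta(D_1)+\beta(D_2)$ if $\beta(D_1)\ge\beta(D_3)$.
   Context: There are $N$ messages $\mathcal{M}=\{x_1,\dots,x_N\}$, $x_i\in\{0,1\}^t$, and $N$ receivers; receiver $r$ requests $x_r$ and knows $\{x_j: j\in N_D^+(r)\}$, where $D$ is a loopless digraph on $V(D)=\{1,\dots,N\}$ (the side-information digraph) and $N_D^+(r)$ is the out-neighborhood of $r$. Single sender: an index code is an encoding function of all messages into $\{0,1\}^p$ together with decoding functions by which every receiver $r$ recovers $x_r$, for all message realizations, from the codeword and its side information. $\beta_t(D)$ is the minimum of $p/t$ over index codes for $t$-bit messages, and $\beta(D)=\inf_t\beta_t(D)=\lim_{t\to\infty}\beta_t(D)$. (The empty digraph has rate $0$.) Two senders: senders $S_1,S_2$ know $\mathcal{M}_1,\mathcal{M}_2$ with $\mathcal{M}_1\cup\mathcal{M}_2=\mathcal{M}$.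 A two-sender index code consists of encoding functions $\mathscr{F}_s:\{0,1\}^{|\mathcal{M}_s|t}\to\{0,1\}^{p_s}$, $s=1,2$ ($p_s\ge0$ an integer), and decoding functions by which every receiver $r$ recovers $x_r$, for all message realizations, from both sub-codewords and its side information. $\beta_t(D,G_o)$ is the minimum of $(p_1+p_2)/t$ over two-sender index codes for $t$-bit messages, and $\beta(D,G_o)=\inf_t\beta_t(D,G_o)=\lim_{t\to\infty}\beta_t(D,G_o)$. Here $G_o$ (the sender-constraint graph, with vertex set $V(D)$ and an edge $ij$ iff one of $x_i,x_j$ is in $\mathcal{M}_1\setminus\mathcal{M}_2$ and the other in $\mathcal{M}_2\setminus\mathcal{M}_1$) records the senders' message sets. Let $\mathcal{P}_1=\mathcal{M}_1\setminus\mathcal{M}_2$, $\mathcal{P}_2=\mathcal{M}_2\setminus\mathcal{M}_1$, $\mathcal{P}_3=\mathcal{M}_1\cap\mathcal{M}_2$. For $i\in\{1,2,3\}$, $D_i$ is the sub-digraph of $D$ induced by $\{j:x_j\in\mathcal{P}_i\}$. The digraph $f(D)$ has vertex set $\{1,2,3\}$, and $(i,j)$, $i\neq j$, is an arc of $f(D)$ iff there is an arc of $D$ from some vertex of $D_i$ to some vertex of $D_j$. The interaction is fully participated if, whenever $(i,j)$ is an arc of $f(D)$, every vertex of $D_i$ has arcs to all vertices of $D_j$. *)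

theory Defs
  imports Complex_Main "HOL-Library.FuncSet" "Graph_Theory.Graph_Theory"
begin

section \<open>Single-sender index coding\<close>

definition words :: "nat \<Rightarrow> bool list set" where
  "words n = {w. length w = n}"

text \<open>Realizations of the \<open>t\<close>-bit messages whose indices lie in \<open>V\<close>
  (extensional functions, so a realization is exactly a family indexed by \<open>V\<close>).\<close>

definition realizations :: "nat \<Rightarrow> 'a set \<Rightarrow> ('a \<Rightarrow> bool list) set" where
  "realizations t V = (\<Pi>\<^sub>E j\<in>V. words t)"

definition out_neighborhood :: "('a, 'b) pre_digraph \<Rightarrow> 'a \<Rightarrow> 'a set" where
  "out_neighborhood D r = {j. r \<rightarrow>\<^bsub>D\<^esub> j}"

text \<open>The digraph \<open>D\<close> is the side-information digraph: its vertices index both the messages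
  and the receivers, receiver \<open>r\<close> requests \<open>x r\<close> and knows \<open>x\<close> on the out-neighborhood of \<open>r\<close>.
  \<open>dec r\<close> is the decoding function of receiver \<open>r\<close>.\<close>

definition index_code ::
  "nat \<Rightarrow> ('a, 'b) pre_digraph \<Rightarrow> nat \<Rightarrow> (('a \<Rightarrow> bool list) \<Rightarrow> bool list) \<Rightarrow>
   ('a \<Rightarrow> bool list \<Rightarrow> ('a \<Rightarrow> bool list) \<Rightarrow> bool list) \<Rightarrow> bool" where
  "index_code t D p enc dec \<longleftrightarrow>
     enc \<in> realizations t (verts D) \<rightarrow> words p \<and>
     (\<forall>r\<in>verts D.
        dec r \<in> words p \<rightarrow> realizations t (out_neighborhood D r) \<rightarrow> words t \<and>
        (\<forall>x\<in>realizations t (verts D).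
           dec r (enc x) (restrict x (out_neighborhood D r)) = x r))"

definition rate_t :: "nat \<Rightarrow> ('a, 'b) pre_digraph \<Rightarrow> real" where
  "rate_t t D = real (LEAST p. \<exists>enc dec. index_code t D p enc dec) / real t"

definition rate :: "('a, 'b) pre_digraph \<Rightarrow> real" where
  "rate D = (INF t\<in>{1..}. rate_t t D)"

section \<open>Two-sender index coding\<close>

text \<open>\<open>M1\<close> and \<open>M2\<close> are the sets of indices of the messages known to the two senders. The
  sender-constraint graph is only a record of these two sets, so the rates below take
  the sets themselves as arguments.\<close>

definition two_sender_index_code ::
  "nat \<Rightarrow> ('a, 'b) pre_digraph \<Rightarrow> 'a set \<Rightarrow> 'a set \<Rightarrow> nat \<Rightarrow> nat \<Rightarrow>
   (('a \<Rightarrow> bool list) \<Rightarrow> bool list) \<Rightarrow> (('a \<Rightarrow> bool list) \<Rightarrow> bool list) \<Rightarrow>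
   ('a \<Rightarrow> bool list \<Rightarrow> bool list \<Rightarrow> ('a \<Rightarrow> bool list) \<Rightarrow> bool list) \<Rightarrow> bool" where
  "two_sender_index_code t D M1 M2 p1 p2 enc1 enc2 dec \<longleftrightarrow>
     enc1 \<in> realizations t M1 \<rightarrow> words p1 \<and>
     enc2 \<in> realizations t M2 \<rightarrow> words p2 \<and>
     (\<forall>r\<in>verts D.
        dec r \<in> words p1 \<rightarrow> words p2 \<rightarrow> realizations t (out_neighborhood D r) \<rightarrow> words t \<and>
        (\<forall>x\<in>realizations t (verts D).
           dec r (enc1 (restrict x M1)) (enc2 (restrict x M2))
             (restrict x (out_neighborhood D r)) = x r))"

definition two_sender_rate_t ::
  "nat \<Rightarrow> ('a, 'b) pre_digraph \<Rightarrow> 'a set \<Rightarrow> 'a set \<Rightarrow> real" where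
  "two_sender_rate_t t D M1 M2 =
     real (LEAST q. \<exists>p1 p2 enc1 enc2 dec.
             q = p1 + p2 \<and> two_sender_index_code t D M1 M2 p1 p2 enc1 enc2 dec) / real t"

definition two_sender_rate :: "('a, 'b) pre_digraph \<Rightarrow> 'a set \<Rightarrow> 'a set \<Rightarrow> real" where
  "two_sender_rate D M1 M2 = (INF t\<in>{1..}. two_sender_rate_t t D M1 M2)"

section \<open>Sub-digraphs and their interaction\<close>

text \<open>Only the indices \<open>1\<close>, \<open>2\<close>, \<open>3\<close> are meaningful in the next two definitions.\<close>

definition part :: "'a set \<Rightarrow> 'a set \<Rightarrow> nat \<Rightarrow> 'a set" where
  "part M1 M2 i = (if i = 1 then M1 - M2 else if i = 2 then M2 - M1 else M1 \<inter> M2)"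

definition sub_digraph ::
  "('a, 'b) pre_digraph \<Rightarrow> 'a set \<Rightarrow> 'a set \<Rightarrow> nat \<Rightarrow> ('a, 'b) pre_digraph" where
  "sub_digraph D M1 M2 i = D \<restriction> part M1 M2 i"

definition interaction_digraph ::
  "('a, 'b) pre_digraph \<Rightarrow> 'a set \<Rightarrow> 'a set \<Rightarrow> nat pair_pre_digraph" where
  "interaction_digraph D M1 M2 =
     \<lparr> pverts = {1, 2, 3},
       parcs = {(i, j). i \<in> {1, 2, 3} \<and> j \<in> {1, 2, 3} \<and> i \<noteq> j \<and>
         (\<exists>u\<in>verts (sub_digraph D M1 M2 i). \<exists>v\<in>verts (sub_digraph D M1 M2 j). u \<rightarrow>\<^bsub>D\<^esub> v)} \<rparr>"

definition fully_participated :: "('a, 'b) pre_digraph \<Rightarrow> 'a set \<Rightarrow> 'a set \<Rightarrow> bool" where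
  "fully_participated D M1 M2 \<longleftrightarrow>
     (\<forall>(i, j)\<in>parcs (interaction_digraph D M1 M2).
        \<forall>u\<in>verts (sub_digraph D M1 M2 i). \<forall>v\<in>verts (sub_digraph D M1 M2 j). u \<rightarrow>\<^bsub>D\<^esub> v)"

end

theory Submission
  imports Defs
begin

text \<open>Sender 1 transmits the bitwise sum of the (padded) codewords for \<open>D1\<close> and \<open>D3\<close>, and sender 2
  the codeword for \<open>D2\<close>. A receiver in \<open>D1\<close> knows every message of \<open>D3\<close> and conversely, so each
  cancels the summand it does not need; this is the upper bound. For the lower bound, fixing all
  messages outside \<open>D1\<close> makes the second sub-codeword constant, so the first encoder is an
  index code for \<open>D1\<close>, and symmetrically for \<open>D2\<close>. The asymptotic upper bound follows
  because \<open>rate_t\<close> does not increase when \<open>t\<close> is replaced by a multiple, so message lengths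
  that are nearly optimal for \<open>D1\<close>, \<open>D2\<close>, \<open>D3\<close> separately have a common multiple that is nearly
  optimal for all three.\<close>

section \<open>Codes without decoders\<close>

text \<open>Decoders exist iff no receiver confuses two realizations that agree on its side
  information.\<close>

definition decodable :: "nat \<Rightarrow> ('a, 'b) pre_digraph \<Rightarrow> (('a \<Rightarrow> bool list) \<Rightarrow> 'c) \<Rightarrow> bool" where
  "decodable t D f \<longleftrightarrow>
     (\<forall>r\<in>verts D. \<forall>x\<in>realizations t (verts D). \<forall>y\<in>realizations t (verts D).
        f x = f y \<longrightarrow> (\<forall>j\<in>out_neighborhood D r. x j = y j) \<longrightarrow> x r = y r)"

lemma decodableD:
  assumes "decodable t D f" "r \<in> verts D"
    and "x \<in> realizations t (verts D)" "y \<in> realizations t (verts D)"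
    and "f x = f y" "\<And>j. j \<in> out_neighborhood D r \<Longrightarrow> x j = y j"
  shows "x r = y r"
  using assms unfolding decodable_def by blast

lemma realizationsD: "x \<in> realizations t V \<Longrightarrow> j \<in> V \<Longrightarrow> length (x j) = t"
  by (auto simp: realizations_def words_def PiE_iff)

lemma realizations_restrict:
  "(\<And>j. j \<in> S \<Longrightarrow> length (x j) = t) \<Longrightarrow> restrict x S \<in> realizations t S"
  by (auto simp: realizations_def words_def)

lemma realizations_restrict_subset:
  "x \<in> realizations t V \<Longrightarrow> S \<subseteq> V \<Longrightarrow> restrict x S \<in> realizations t S"
  by (intro realizations_restrict) (auto dest: realizationsD)

text \<open>A receiver can decode by picking any realization consistent with the codeword and its
  side information: decodability makes the requested message independent of the choice. The codomain
  of \<open>f\<close> is left general so that it can also be a pair of sub-codewords.\<close>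

lemma decodable_iff_decoder:
  "decodable t D f \<longleftrightarrow>
     (\<exists>dec. \<forall>r\<in>verts D. (\<forall>c s. dec r c s \<in> words t) \<and>
        (\<forall>x\<in>realizations t (verts D). dec r (f x) (restrict x (out_neighborhood D r)) = x r))"
    (is "_ \<longleftrightarrow> (\<exists>dec. ?P dec)")
proof
  assume dec: "decodable t D f"
  let ?Q = "\<lambda>r c s x. x \<in> realizations t (verts D) \<and> f x = c \<and>
                        restrict x (out_neighborhood D r) = s"
  \<comment> \<open>Inputs that arise from no realization get a default word; only its length
    \<open>t\<close> matters, for the range condition.\<close>
  define d where "d r c s = (if \<exists>x. ?Q r c s x then (SOME x. ?Q r c s x) r else replicate t False)"
    for r c s
  have d: "\<exists>x. ?Q r c s x \<Longrightarrow> \<exists>x. ?Q r c s x \<and> d r c s = x r" for r c s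
  proof -
    assume ex: "\<exists>x. ?Q r c s x"
    show ?thesis
      using someI_ex[OF ex] if_P[OF ex, of "(SOME x. ?Q r c s x) r" "replicate t False"]
      unfolding d_def by blast
  qed
  have "d r c s \<in> words t" if "r \<in> verts D" for r c s
  proof (cases "\<exists>x. ?Q r c s x")
    case True
    then obtain y where "y \<in> realizations t (verts D)" "d r c s = y r" using d[OF True] by blast
    then show ?thesis using realizationsD[OF _ that] by (simp add: words_def)
  next
    case False
    then have "d r c s = replicate t False" unfolding d_def by (rule if_not_P)
    then show ?thesis by (simp add: words_def)
  qed
  moreover have "d r (f x) (restrict x (out_neighborhood D r)) = x r"
    if r: "r \<in> verts D" and x: "x \<in> realizations t (verts D)" for r x
  proof -
    obtain y where y: "?Q r (f x) (restrict x (out_neighborhood D r)) y"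
      and dy: "d r (f x) (restrict x (out_neighborhood D r)) = y r"
      using d[of "f x" r "restrict x (out_neighborhood D r)"] x by blast
    have "y j = x j" if "j \<in> out_neighborhood D r" for j
      using y that by (metis restrict_apply')
    then have "y r = x r" using y by (intro decodableD[OF dec r _ x]) blast+
    then show ?thesis using dy by simp
  qed
  ultimately show "\<exists>dec. ?P dec" by (intro exI[of _ d]) blast
next
  assume "\<exists>dec. ?P dec"
  then obtain d where d: "?P d" ..
  show "decodable t D f" unfolding decodable_def
  proof (intro ballI impI)
    fix r x y
    assume *: "r \<in> verts D" "x \<in> realizations t (verts D)" "y \<in> realizations t (verts D)"
      "f x = f y" "\<forall>j\<in>out_neighborhood D r. x j = y j"
    have "restrict x (out_neighborhood D r) = restrict y (out_neighborhood D r)"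
      using *(5) by (auto simp: restrict_def)
    moreover have "d r (f x) (restrict x (out_neighborhood D r)) = x r"
      "d r (f y) (restrict y (out_neighborhood D r)) = y r"
      using d *(1-3) by blast+
    ultimately show "x r = y r" using *(4) by simp
  qed
qed

text \<open>The forward direction is argued directly: the decoders of an \<open>index_code\<close>
  have a range condition on actual words and realizations only, while
  \<open>decodable_iff_decoder\<close> asks for one on all inputs.\<close>

lemma index_code_iff_decodable:
  "(\<exists>dec. index_code t D p enc dec) \<longleftrightarrow>
     enc \<in> realizations t (verts D) \<rightarrow> words p \<and> decodable t D enc"
proof
  assume "\<exists>dec. index_code t D p enc dec"
  then obtain dec where dec: "index_code t D p enc dec" ..
  have "decodable t D enc" unfolding decodable_def
  proof (intro ballI impI)
    fix r x y
    assume *: "r \<in> verts D" "x \<in> realizations t (verts D)" "y \<in> realizations t (verts D)"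
      "enc x = enc y" "\<forall>j\<in>out_neighborhood D r. x j = y j"
    have "restrict x (out_neighborhood D r) = restrict y (out_neighborhood D r)"
      using *(5) by (auto simp: restrict_def)
    moreover have "dec r (enc x) (restrict x (out_neighborhood D r)) = x r"
      "dec r (enc y) (restrict y (out_neighborhood D r)) = y r"
      using dec *(1-3) unfolding index_code_def by blast+
    ultimately show "x r = y r" using *(4) by simp
  qed
  then show "enc \<in> realizations t (verts D) \<rightarrow> words p \<and> decodable t D enc"
    using dec by (simp add: index_code_def)
next
  assume "enc \<in> realizations t (verts D) \<rightarrow> words p \<and> decodable t D enc"
  then show "\<exists>dec. index_code t D p enc dec"
    unfolding decodable_iff_decoder index_code_def Pi_iff by blast
qed

text \<open>Bundling both sub-codewords into one value lets \<open>decodable\<close> treat a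
  two-sender code as an ordinary code whose encoder has a constrained form.\<close>

definition two_sender_encode ::
  "'a set \<Rightarrow> 'a set \<Rightarrow> (('a \<Rightarrow> bool list) \<Rightarrow> 'c) \<Rightarrow> (('a \<Rightarrow> bool list) \<Rightarrow> 'd) \<Rightarrow>
   ('a \<Rightarrow> bool list) \<Rightarrow> 'c \<times> 'd" where
  "two_sender_encode M1 M2 enc1 enc2 x = (enc1 (restrict x M1), enc2 (restrict x M2))"

lemma two_sender_index_code_iff_decodable:
  "(\<exists>dec. two_sender_index_code t D M1 M2 p1 p2 enc1 enc2 dec) \<longleftrightarrow>
     enc1 \<in> realizations t M1 \<rightarrow> words p1 \<and> enc2 \<in> realizations t M2 \<rightarrow> words p2 \<and>
     decodable t D (two_sender_encode M1 M2 enc1 enc2)"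
proof
  assume "\<exists>dec. two_sender_index_code t D M1 M2 p1 p2 enc1 enc2 dec"
  then obtain dec where dec: "two_sender_index_code t D M1 M2 p1 p2 enc1 enc2 dec" ..
  have "decodable t D (two_sender_encode M1 M2 enc1 enc2)" unfolding decodable_def
  proof (intro ballI impI)
    fix r x y
    assume *: "r \<in> verts D" "x \<in> realizations t (verts D)" "y \<in> realizations t (verts D)"
      "two_sender_encode M1 M2 enc1 enc2 x = two_sender_encode M1 M2 enc1 enc2 y"
      "\<forall>j\<in>out_neighborhood D r. x j = y j"
    have "restrict x (out_neighborhood D r) = restrict y (out_neighborhood D r)"
      using *(5) by (auto simp: restrict_def)
    moreover have "dec r (enc1 (restrict x M1)) (enc2 (restrict x M2))
        (restrict x (out_neighborhood D r)) = x r"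
      "dec r (enc1 (restrict y M1)) (enc2 (restrict y M2))
        (restrict y (out_neighborhood D r)) = y r"
      using dec *(1-3) unfolding two_sender_index_code_def by blast+
    ultimately show "x r = y r" using *(4) by (simp add: two_sender_encode_def)
  qed
  then show "enc1 \<in> realizations t M1 \<rightarrow> words p1 \<and> enc2 \<in> realizations t M2 \<rightarrow> words p2 \<and>
      decodable t D (two_sender_encode M1 M2 enc1 enc2)"
    using dec by (simp add: two_sender_index_code_def)
next
  assume *: "enc1 \<in> realizations t M1 \<rightarrow> words p1 \<and> enc2 \<in> realizations t M2 \<rightarrow> words p2 \<and>
      decodable t D (two_sender_encode M1 M2 enc1 enc2)"
  then obtain d where "\<forall>r\<in>verts D. (\<forall>c s. d r c s \<in> words t) \<and>
        (\<forall>x\<in>realizations t (verts D). d r (two_sender_encode M1 M2 enc1 enc2 x)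
            (restrict x (out_neighborhood D r)) = x r)"
    unfolding decodable_iff_decoder by blast
  then have "two_sender_index_code t D M1 M2 p1 p2 enc1 enc2 (\<lambda>r c1 c2. d r (c1, c2))"
    using * unfolding two_sender_index_code_def two_sender_encode_def Pi_iff by simp
  then show "\<exists>dec. two_sender_index_code t D M1 M2 p1 p2 enc1 enc2 dec" by blast
qed

section \<open>Optimal codeword lengths\<close>

definition codable :: "nat \<Rightarrow> ('a, 'b) pre_digraph \<Rightarrow> nat \<Rightarrow> bool" where
  "codable t D p \<longleftrightarrow> (\<exists>enc\<in>realizations t (verts D) \<rightarrow> words p. decodable t D enc)"

definition code_length :: "nat \<Rightarrow> ('a, 'b) pre_digraph \<Rightarrow> nat" where
  "code_length t D = (LEAST p. codable t D p)"

definition two_sender_codable ::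
  "nat \<Rightarrow> ('a, 'b) pre_digraph \<Rightarrow> 'a set \<Rightarrow> 'a set \<Rightarrow> nat \<Rightarrow> nat \<Rightarrow> bool" where
  "two_sender_codable t D M1 M2 p1 p2 \<longleftrightarrow>
     (\<exists>enc1\<in>realizations t M1 \<rightarrow> words p1. \<exists>enc2\<in>realizations t M2 \<rightarrow> words p2.
        decodable t D (two_sender_encode M1 M2 enc1 enc2))"

definition two_sender_code_length ::
  "nat \<Rightarrow> ('a, 'b) pre_digraph \<Rightarrow> 'a set \<Rightarrow> 'a set \<Rightarrow> nat" where
  "two_sender_code_length t D M1 M2 =
     (LEAST q. \<exists>p1 p2. q = p1 + p2 \<and> two_sender_codable t D M1 M2 p1 p2)"

lemma rate_t_eq: "rate_t t D = real (code_length t D) / real t"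
  unfolding rate_t_def code_length_def codable_def index_code_iff_decodable
  by (simp add: Bex_def)

lemma two_sender_rate_t_eq:
  "two_sender_rate_t t D M1 M2 = real (two_sender_code_length t D M1 M2) / real t"
proof -
  have "(\<exists>p1 p2 enc1 enc2 dec. q = p1 + p2 \<and>
           two_sender_index_code t D M1 M2 p1 p2 enc1 enc2 dec) \<longleftrightarrow>
        (\<exists>p1 p2. q = p1 + p2 \<and> two_sender_codable t D M1 M2 p1 p2)" for q
    unfolding two_sender_codable_def Bex_def
    using two_sender_index_code_iff_decodable[of t D M1 M2] by metis
  then show ?thesis
    unfolding two_sender_rate_t_def two_sender_code_length_def by simp
qed

section \<open>Existence, padding and concatenation of codes\<close>

lemma code_length_le: "codable t D p \<Longrightarrow> code_length t D \<le> p"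
  unfolding code_length_def by (rule Least_le)

lemma two_sender_code_length_le:
  "two_sender_codable t D M1 M2 p1 p2 \<Longrightarrow> two_sender_code_length t D M1 M2 \<le> p1 + p2"
  unfolding two_sender_code_length_def by (rule Least_le) blast

text \<open>Padding with constant bits loses no information. It later brings the codes for
  \<open>D1\<close> and \<open>D3\<close> to a common length.\<close>

lemma codable_mono:
  assumes "codable t D p" "p \<le> q"
  shows "codable t D q"
proof -
  obtain e where e: "e \<in> realizations t (verts D) \<rightarrow> words p" "decodable t D e"
    using assms unfolding codable_def by blast
  have "decodable t D (\<lambda>x. e x @ replicate (q - p) False)"
    using e(2) unfolding decodable_def by simp
  moreover have "(\<lambda>x. e x @ replicate (q - p) False) \<in> realizations t (verts D) \<rightarrow> words q"
    using e(1) assms(2) by (auto simp: words_def Pi_iff)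
  ultimately show ?thesis unfolding codable_def by blast
qed

text \<open>Without some code the \<open>LEAST\<close> in \<open>code_length\<close> would be
  unspecified. An injective encoder is decodable whatever the arcs are, and \<open>n\<close> bits
  suffice for \<open>n\<close> realizations since \<open>n\<close> is at most
  \<open>2 ^ n\<close>.\<close>

lemma codable_ex:
  assumes "finite (verts D)"
  shows "\<exists>p. codable t D p"
proof -
  let ?R = "realizations t (verts D)" and ?n = "card (realizations t (verts D))"
  have words: "words p = {w. set w \<subseteq> (UNIV :: bool set) \<and> length w = p}" for p
    by (simp add: words_def)
  have fw: "finite (words p)" for p
    unfolding words by (rule finite_lists_length_eq) simp
  have "card (words ?n) = 2 ^ ?n"
    unfolding words using card_lists_length_eq[of "UNIV :: bool set" ?n] by simp
  then have "?n \<le> card (words ?n)" by (simp add: less_imp_le)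
  moreover have "finite ?R"
    unfolding realizations_def using assms fw by (simp add: finite_PiE)
  ultimately obtain e where "e ` ?R \<subseteq> words ?n" "inj_on e ?R"
    using card_le_inj[of ?R "words ?n"] fw by blast
  then have "e \<in> ?R \<rightarrow> words ?n" "decodable t D e"
    unfolding decodable_def by (auto dest: inj_onD)
  then show ?thesis unfolding codable_def by blast
qed

lemma codable_code_length: "finite (verts D) \<Longrightarrow> codable t D (code_length t D)"
  unfolding code_length_def by (rule LeastI_ex) (rule codable_ex)

text \<open>Each message is cut into its first \<open>s\<close> and its last \<open>t\<close> bits;
  the two halves are encoded separately and the codewords concatenated.\<close>

lemma codable_add:
  assumes "codable s D p" "codable t D q"
  shows "codable (s + t) D (p + q)"
proof -
  let ?V = "verts D"
  obtain d where d: "d \<in> realizations s ?V \<rightarrow> words p" "decodable s D d"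
    using assms(1) unfolding codable_def by blast
  obtain e where e: "e \<in> realizations t ?V \<rightarrow> words q" "decodable t D e"
    using assms(2) unfolding codable_def by blast
  define f g where "f x = (\<lambda>j\<in>?V. take s (x j))" and "g x = (\<lambda>j\<in>?V. drop s (x j))"
    for x :: "'a \<Rightarrow> bool list"
  have f: "f x \<in> realizations s ?V" and g: "g x \<in> realizations t ?V"
    if "x \<in> realizations (s + t) ?V" for x
    unfolding f_def g_def using that by (auto intro!: realizations_restrict dest: realizationsD)
  let ?h = "\<lambda>x. d (f x) @ e (g x)"
  have "?h \<in> realizations (s + t) ?V \<rightarrow> words (p + q)"
    using d(1) e(1) f g by (force simp: words_def Pi_iff)
  moreover have "decodable (s + t) D ?h" unfolding decodable_def
  proof (intro ballI impI)
    fix r x y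
    assume r: "r \<in> ?V" and x: "x \<in> realizations (s + t) ?V" and y: "y \<in> realizations (s + t) ?V"
      and eq: "?h x = ?h y" and side: "\<forall>j\<in>out_neighborhood D r. x j = y j"
    \<comment> \<open>The first blocks have equal length, so equal concatenations agree block by
      block.\<close>
    have "length (d (f x)) = length (d (f y))"
      using d(1) f[OF x] f[OF y] by (auto simp: words_def Pi_iff)
    then have de: "d (f x) = d (f y)" "e (g x) = e (g y)" using eq by auto
    have "f x j = f y j" "g x j = g y j" if "j \<in> out_neighborhood D r" for j
      using side that by (auto simp: f_def g_def restrict_def)
    then have "f x r = f y r" "g x r = g y r"
      using decodableD[OF d(2) r f[OF x] f[OF y] de(1)] decodableD[OF e(2) r g[OF x] g[OF y] de(2)]
      by blast+
    then have "take s (x r) = take s (y r)" "drop s (x r) = drop s (y r)"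
      using r by (auto simp: f_def g_def)
    then show "x r = y r" by (metis append_take_drop_id)
  qed
  ultimately show ?thesis unfolding codable_def by blast
qed

lemma code_length_mult_le:
  assumes "finite (verts D)" "k \<ge> 1"
  shows "code_length (k * t) D \<le> k * code_length t D"
  using assms(2)
proof (induction k rule: dec_induct)
  case base
  then show ?case by simp
next
  case (step k)
  have "codable (t + k * t) D (code_length t D + code_length (k * t) D)"
    using assms(1) by (intro codable_add codable_code_length)
  then show ?case using step.IH code_length_le by fastforce
qed

lemma rate_t_mult_le:
  assumes "finite (verts D)" "k \<ge> 1"
  shows "rate_t (k * t) D \<le> rate_t t D"
proof -
  have "real (code_length (k * t) D) \<le> real k * real (code_length t D)"
    using code_length_mult_le[OF assms, of t] by (metis of_nat_le_iff of_nat_mult)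
  then have "real (code_length (k * t) D) / real (k * t)
      \<le> (real k * real (code_length t D)) / real (k * t)"
    by (rule divide_right_mono) simp
  also have "\<dots> = real (code_length t D) / real t" using assms(2) by simp
  finally show ?thesis by (simp add: rate_t_eq)
qed

section \<open>Rates as infima over the message length\<close>

lemma rate_le: "t \<ge> 1 \<Longrightarrow> rate D \<le> rate_t t D"
  unfolding rate_def
  \<comment> \<open>A real infimum is a lower bound only for families bounded below; 0 serves as the
    bound.\<close>
  by (rule cINF_lower) (auto intro!: bdd_belowI[of _ 0] simp: rate_t_eq)

lemma two_sender_rate_le: "t \<ge> 1 \<Longrightarrow> two_sender_rate D M1 M2 \<le> two_sender_rate_t t D M1 M2"
  unfolding two_sender_rate_def
  by (rule cINF_lower) (auto intro!: bdd_belowI[of _ 0] simp: two_sender_rate_t_eq)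

lemma rate_approx:
  assumes "\<epsilon> > 0"
  obtains t where "t \<ge> 1" "rate_t t D < rate D + \<epsilon>"
proof -
  have "\<exists>t\<in>{1..}. rate_t t D < rate D + \<epsilon>"
    using assms unfolding rate_def
    by (intro cINF_less_iff[THEN iffD1]) (auto intro!: bdd_belowI[of _ 0] simp: rate_t_eq)
  then show ?thesis using that by auto
qed

section \<open>Bounds on the two-sender rate\<close>

lemma out_neighborhood_induce_subgraph:
  "r \<in> S \<Longrightarrow> out_neighborhood (D \<restriction> S) r = out_neighborhood D r \<inter> S"
  by (auto simp: out_neighborhood_def arcs_ends_def arc_to_ends_def)

text \<open>Exchanging the senders turns a bound for the private part of the first into one for the
  second.\<close>

lemma two_sender_codable_commute:
  "two_sender_codable t D M1 M2 p1 p2 \<longleftrightarrow> two_sender_codable t D M2 M1 p2 p1"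
proof -
  have "decodable t D (two_sender_encode M1 M2 e1 e2) \<longleftrightarrow>
        decodable t D (two_sender_encode M2 M1 e2 e1)" for e1 e2
    unfolding decodable_def two_sender_encode_def by auto
  then show ?thesis unfolding two_sender_codable_def by blast
qed

lemma codable_private_part:
  assumes "two_sender_codable t D M1 M2 p1 p2" and V: "verts D = M1 \<union> M2"
  shows "codable t (D \<restriction> (M1 - M2)) p1"
proof -
  let ?P = "M1 - M2"
  obtain e1 e2 where e1: "e1 \<in> realizations t M1 \<rightarrow> words p1"
    and "e2 \<in> realizations t M2 \<rightarrow> words p2"
    and dec: "decodable t D (two_sender_encode M1 M2 e1 e2)"
    using assms(1) unfolding two_sender_codable_def by (elim bexE) (rule that)
  \<comment> \<open>All messages outside \<open>?P\<close> are frozen at the zero word. Sender 2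
    knows nothing of \<open>?P\<close>, so its sub-codeword becomes constant and \<open>e1\<close>
    must do all the work.\<close>
  define ext where "ext x = (\<lambda>j\<in>M1 \<union> M2. if j \<in> ?P then x j else replicate t False)"
    for x :: "'a \<Rightarrow> bool list"
  define e where "e x = e1 (restrict (ext x) M1)" for x
  have ext: "ext x \<in> realizations t (verts D)" if "x \<in> realizations t ?P" for x
    unfolding ext_def V by (rule realizations_restrict) (simp add: realizationsD[OF that])
  have const: "restrict (ext x) M2 = restrict (ext y) M2" for x y
    by (rule restrict_ext) (simp add: ext_def)
  have "e \<in> realizations t ?P \<rightarrow> words p1"
  proof
    fix x assume "x \<in> realizations t ?P"
    then have "restrict (ext x) M1 \<in> realizations t M1"
      by (rule realizations_restrict_subset[OF ext]) (simp add: V)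
    then show "e x \<in> words p1" unfolding e_def by (rule Pi_mem[OF e1])
  qed
  moreover have "decodable t (D \<restriction> ?P) e" unfolding decodable_def
  proof (intro ballI impI)
    fix r x y
    assume rxy: "r \<in> verts (D \<restriction> ?P)" "x \<in> realizations t (verts (D \<restriction> ?P))"
      "y \<in> realizations t (verts (D \<restriction> ?P))"
      and eq: "e x = e y" and side: "\<forall>j\<in>out_neighborhood (D \<restriction> ?P) r. x j = y j"
    have r: "r \<in> ?P" and x: "x \<in> realizations t ?P" and y: "y \<in> realizations t ?P"
      using rxy by simp_all
    have rV: "r \<in> verts D" using r unfolding V by blast
    have "ext x r = ext y r"
    proof (rule decodableD[OF dec rV ext[OF x] ext[OF y]])
      show "two_sender_encode M1 M2 e1 e2 (ext x) = two_sender_encode M1 M2 e1 e2 (ext y)"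
        by (simp only: two_sender_encode_def eq[unfolded e_def] const[of x y])
      show "ext x j = ext y j" if "j \<in> out_neighborhood D r" for j
      \<comment> \<open>Side information outside \<open>?P\<close> is frozen too, so it cannot help
        a receiver beyond what it knows within \<open>?P\<close>.\<close>
      proof (cases "j \<in> ?P")
        case True
        then have "j \<in> out_neighborhood (D \<restriction> ?P) r"
          using that r by (simp add: out_neighborhood_induce_subgraph)
        then show ?thesis using side unfolding ext_def by simp
      next
        case False
        then show ?thesis unfolding ext_def by simp
      qed
    qed
    then show "x r = y r" using r by (simp add: ext_def)
  qed
  ultimately show ?thesis unfolding codable_def induce_subgraph_verts by blast
qed

section \<open>Upper bound by a bitwise sum\<close>

text \<open>Adding a fixed word is injective. Equal lengths matter, as \<open>map2\<close> truncates
  to the shorter list; the two forms cancel the left and the right summand.\<close>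

lemma map2_xor_cancel:
  "length u = length v \<Longrightarrow> length u = length w \<Longrightarrow>
   map2 (\<noteq>) u v = map2 (\<noteq>) u w \<longleftrightarrow> v = w"
  "length u = length v \<Longrightarrow> length u = length w \<Longrightarrow>
   map2 (\<noteq>) v u = map2 (\<noteq>) w u \<longleftrightarrow> v = w"
  for u v w :: "bool list"
  by (auto simp: list_eq_iff_nth_eq)

lemma two_sender_codable_xor:
  assumes V: "verts D = M1 \<union> M2"
    and arcs: "\<And>u v. u \<in> M1 - M2 \<Longrightarrow> v \<in> M1 \<inter> M2 \<Longrightarrow> u \<rightarrow>\<^bsub>D\<^esub> v \<and> v \<rightarrow>\<^bsub>D\<^esub> u"
    and "codable t (D \<restriction> (M1 - M2)) m" "codable t (D \<restriction> (M2 - M1)) p"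
    and "codable t (D \<restriction> (M1 \<inter> M2)) m"
  shows "two_sender_codable t D M1 M2 m p"
proof -
  let ?P1 = "M1 - M2" and ?P2 = "M2 - M1" and ?P3 = "M1 \<inter> M2"
  obtain a where a: "a \<in> realizations t ?P1 \<rightarrow> words m" "decodable t (D \<restriction> ?P1) a"
    using assms(3) unfolding codable_def induce_subgraph_verts by blast
  obtain b where b: "b \<in> realizations t ?P2 \<rightarrow> words p" "decodable t (D \<restriction> ?P2) b"
    using assms(4) unfolding codable_def induce_subgraph_verts by blast
  obtain c where c: "c \<in> realizations t ?P3 \<rightarrow> words m" "decodable t (D \<restriction> ?P3) c"
    using assms(5) unfolding codable_def induce_subgraph_verts by blast
  let ?R = "realizations t (verts D)"
  define e1 where "e1 x = map2 (\<noteq>) (a (restrict x ?P1)) (c (restrict x ?P3))" for x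
  define e2 where "e2 x = b (restrict x ?P2)" for x
  \<comment> \<open>Stated for any \<open>S\<close> containing \<open>M1\<close>: it is used for
    what sender 1 sees and for realizations of all messages.\<close>
  have len: "length (a (restrict x ?P1)) = m" "length (c (restrict x ?P3)) = m"
    if "x \<in> realizations t S" "M1 \<subseteq> S" for x S
  proof -
    have "restrict x ?P1 \<in> realizations t ?P1" "restrict x ?P3 \<in> realizations t ?P3"
      using that(2) by (auto intro: realizations_restrict_subset[OF that(1)])
    then show "length (a (restrict x ?P1)) = m" "length (c (restrict x ?P3)) = m"
      using a(1) c(1) by (auto simp: words_def Pi_iff)
  qed
  have "e1 \<in> realizations t M1 \<rightarrow> words m"
    using len by (auto simp: e1_def words_def)
  moreover have "e2 \<in> realizations t M2 \<rightarrow> words p"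
  proof
    fix x assume "x \<in> realizations t M2"
    then have "restrict x ?P2 \<in> realizations t ?P2"
      by (rule realizations_restrict_subset) simp
    then show "e2 x \<in> words p" unfolding e2_def by (rule Pi_mem[OF b(1)])
  qed
  moreover have "decodable t D (two_sender_encode M1 M2 e1 e2)" unfolding decodable_def
  proof (intro ballI impI)
    fix r x y
    assume r: "r \<in> verts D" and x: "x \<in> ?R" and y: "y \<in> ?R"
      and eq: "two_sender_encode M1 M2 e1 e2 x = two_sender_encode M1 M2 e1 e2 y"
      and side: "\<forall>j\<in>out_neighborhood D r. x j = y j"
    have sub: "M1 \<inter> ?P1 = ?P1" "M1 \<inter> ?P3 = ?P3" "M2 \<inter> ?P2 = ?P2" by auto
    have eq1: "map2 (\<noteq>) (a (restrict x ?P1)) (c (restrict x ?P3)) =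
               map2 (\<noteq>) (a (restrict y ?P1)) (c (restrict y ?P3))"
      and eq2: "b (restrict x ?P2) = b (restrict y ?P2)"
      using eq by (simp_all only: two_sender_encode_def e1_def e2_def restrict_restrict sub prod.inject)
    have "M1 \<subseteq> verts D" using V by blast
    note lens = len[OF x this] len[OF y this]
    \<comment> \<open>Once the codeword of its own part is isolated, a receiver decodes with the
      code of that part, since its side information there is also available in
      \<open>D\<close>.\<close>
    have part_decode: "x r = y r"
      if "decodable t (D \<restriction> P) f" "r \<in> P" "P \<subseteq> verts D" "f (restrict x P) = f (restrict y P)"
      for P and f :: "('a \<Rightarrow> bool list) \<Rightarrow> bool list"
    proof -
      have "restrict x P r = restrict y P r"
      proof (rule decodableD[OF that(1)])
        show "restrict x P j = restrict y P j" if "j \<in> out_neighborhood (D \<restriction> P) r" for j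
          using that \<open>r \<in> P\<close> side by (simp add: out_neighborhood_induce_subgraph)
        show "r \<in> verts (D \<restriction> P)" using that(2) by simp
        show "restrict x P \<in> realizations t (verts (D \<restriction> P))"
          "restrict y P \<in> realizations t (verts (D \<restriction> P))"
          unfolding induce_subgraph_verts 
          by (rule realizations_restrict_subset[OF x that(3)] realizations_restrict_subset[OF y that(3)])+
      qed (rule that(4))
      then show ?thesis using that(2) by simp
    qed
    consider "r \<in> ?P1" | "r \<in> ?P2" | "r \<in> ?P3" using r V by blast
    then show "x r = y r"
    proof cases
      case 1
      \<comment> \<open>The receiver knows all of \<open>?P3\<close>, so \<open>x\<close> and
        \<open>y\<close> give the same summand \<open>c\<close>, which cancels.\<close>
      then have "restrict x ?P3 = restrict y ?P3"
        using side arcs by (intro restrict_ext) (simp add: out_neighborhood_def)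
      note eq1 = eq1[unfolded this]
      have "a (restrict x ?P1) = a (restrict y ?P1)"
        by (rule map2_xor_cancel(2)[THEN iffD1, OF _ _ eq1]) (simp_all only: lens)
      then show ?thesis using part_decode[OF a(2) 1] V by blast
    next
      case 2
      then show ?thesis using part_decode[OF b(2) 2] V eq2 by blast
    next
      case 3
      then have "restrict x ?P1 = restrict y ?P1"
        using side arcs by (intro restrict_ext) (simp add: out_neighborhood_def)
      note eq1 = eq1[unfolded this]
      have "c (restrict x ?P3) = c (restrict y ?P3)"
        by (rule map2_xor_cancel(1)[THEN iffD1, OF _ _ eq1]) (simp_all only: lens)
      then show ?thesis using part_decode[OF c(2) 3] V by blast
    qed
  qed
  ultimately show ?thesis unfolding two_sender_codable_def by blast
qed

theorem theorem7:
  fixes D :: "(nat, 'b) pre_digraph" and N t :: nat and M1 M2 :: "nat set"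
  assumes "digraph D"
    and "verts D = {1..N}"
    and "M1 \<union> M2 = {1..N}"
    and "fully_participated D M1 M2"
    and "(1, 3) \<in> parcs (interaction_digraph D M1 M2)"
    and "(3, 1) \<in> parcs (interaction_digraph D M1 M2)"
    and "\<not> ((2, 3) \<in> parcs (interaction_digraph D M1 M2) \<and>
            (3, 2) \<in> parcs (interaction_digraph D M1 M2))"
    and "t \<ge> 1"
  defines "D1 \<equiv> sub_digraph D M1 M2 1"
    and "D2 \<equiv> sub_digraph D M1 M2 2"
    and "D3 \<equiv> sub_digraph D M1 M2 3"
  shows "two_sender_rate_t t D M1 M2 \<le> rate_t t D2 + max (rate_t t D1) (rate_t t D3) \<and>
         (rate_t t D1 \<ge> rate_t t D3 \<longrightarrow>
            two_sender_rate_t t D M1 M2 = rate_t t D1 + rate_t t D2) \<and>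
         two_sender_rate D M1 M2 \<le> rate D2 + max (rate D1) (rate D3) \<and>
         (rate D1 \<ge> rate D3 \<longrightarrow>
            two_sender_rate D M1 M2 = rate D1 + rate D2)"
proof -
  have V: "verts D = M1 \<union> M2" using assms(2,3) by simp
  have D1: "D1 = D \<restriction> (M1 - M2)" and D2: "D2 = D \<restriction> (M2 - M1)" and D3: "D3 = D \<restriction> (M1 \<inter> M2)"
    by (simp_all add: D1_def D2_def D3_def sub_digraph_def part_def)
  have "finite (M1 \<union> M2)" using assms(3) by simp
  then have fin: "finite (verts D1)" "finite (verts D2)" "finite (verts D3)"
    by (simp_all add: D1 D2 D3)
  have arcs: "u \<rightarrow>\<^bsub>D\<^esub> v \<and> v \<rightarrow>\<^bsub>D\<^esub> u" if "u \<in> M1 - M2" "v \<in> M1 \<inter> M2" for u v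
  proof -
    have "\<forall>u\<in>verts D1. \<forall>v\<in>verts D3. u \<rightarrow>\<^bsub>D\<^esub> v" "\<forall>u\<in>verts D3. \<forall>v\<in>verts D1. u \<rightarrow>\<^bsub>D\<^esub> v"
      using assms(4,5,6) unfolding fully_participated_def D1_def D3_def by blast+
    then show ?thesis using that by (simp add: D1 D3)
  qed
  \<comment> \<open>The shorter of the codes for \<open>D1\<close> and \<open>D3\<close> is padded
    to the length of the longer.\<close>
  have codable: "two_sender_codable s D M1 M2
      (max (code_length s D1) (code_length s D3)) (code_length s D2)" for s
    by (rule two_sender_codable_xor[OF V arcs];
        (unfold D1[symmetric] D2[symmetric] D3[symmetric])?;
        auto intro: codable_mono[OF codable_code_length] fin)
  \<comment> \<open>Proved for every \<open>s\<close>, since the infima need other message lengths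
    than \<open>t\<close>. At \<open>s = 0\<close> both sides are 0 because division by 0 gives
    0.\<close>
  have upper: "two_sender_rate_t s D M1 M2 \<le> rate_t s D2 + max (rate_t s D1) (rate_t s D3)" for s
  proof -
    have "real (two_sender_code_length s D M1 M2)
        \<le> real (code_length s D2) + max (real (code_length s D1)) (real (code_length s D3))"
      using two_sender_code_length_le[OF codable, of s] by linarith
    then have "real (two_sender_code_length s D M1 M2) / real s
        \<le> (real (code_length s D2) + max (real (code_length s D1)) (real (code_length s D3))) / real s"
      by (rule divide_right_mono) simp
    also have "\<dots> = rate_t s D2 + max (rate_t s D1) (rate_t s D3)"
      by (simp add: rate_t_eq add_divide_distrib max_divide_distrib_right)
    finally show ?thesis by (simp add: two_sender_rate_t_eq)
  qed
  have lower: "rate_t s D1 + rate_t s D2 \<le> two_sender_rate_t s D M1 M2" for s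
  proof -
    \<comment> \<open>The minimum is attained because the code from the upper bound shows that some
      code exists.\<close>
    have "\<exists>p1 p2. two_sender_code_length s D M1 M2 = p1 + p2 \<and> two_sender_codable s D M1 M2 p1 p2"
      unfolding two_sender_code_length_def by (rule LeastI_ex) (use codable in blast)
    then obtain p1 p2 where p: "two_sender_code_length s D M1 M2 = p1 + p2"
      "two_sender_codable s D M1 M2 p1 p2" by blast
    have "code_length s D1 \<le> p1"
      using codable_private_part[OF p(2) V] unfolding D1 by (rule code_length_le)
    moreover have "code_length s D2 \<le> p2"
      using p(2) V codable_private_part[of s D M2 M1 p2 p1] unfolding D2
      by (simp add: two_sender_codable_commute[of _ _ M1] Un_commute code_length_le)
    ultimately have "real (code_length s D1) + real (code_length s D2)
        \<le> real (two_sender_code_length s D M1 M2)" using p(1) by linarith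
    then have "(real (code_length s D1) + real (code_length s D2)) / real s
        \<le> real (two_sender_code_length s D M1 M2) / real s"
      by (rule divide_right_mono) simp
    then show ?thesis by (simp add: rate_t_eq two_sender_rate_t_eq add_divide_distrib)
  qed
  have upper_lim: "two_sender_rate D M1 M2 \<le> rate D2 + max (rate D1) (rate D3)"
  proof (rule field_le_epsilon)
    fix \<epsilon> :: real assume "\<epsilon> > 0"
    \<comment> \<open>One half pays for the \<open>D2\<close> term, the other for whichever term
      attains the maximum.\<close>
    then have "\<epsilon> / 2 > 0" by simp
    then obtain t1 t2 t3 where ge: "t1 \<ge> 1" "t2 \<ge> 1" "t3 \<ge> 1"
      and t1: "rate_t t1 D1 < rate D1 + \<epsilon> / 2"
      and t2: "rate_t t2 D2 < rate D2 + \<epsilon> / 2"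
      and t3: "rate_t t3 D3 < rate D3 + \<epsilon> / 2"
      by (meson rate_approx)
    \<comment> \<open>A common multiple of the three lengths: none of the three rates exceeds its
      nearly optimal value there.\<close>
    let ?s = "t1 * t2 * t3"
    have "rate_t ?s D1 \<le> rate_t t1 D1"
      using rate_t_mult_le[OF fin(1), of "t2 * t3" t1] ge by (simp add: ac_simps)
    moreover have "rate_t ?s D2 \<le> rate_t t2 D2"
      using rate_t_mult_le[OF fin(2), of "t1 * t3" t2] ge by (simp add: ac_simps)
    moreover have "rate_t ?s D3 \<le> rate_t t3 D3"
      using rate_t_mult_le[OF fin(3), of "t1 * t2" t3] ge by simp
    moreover have "two_sender_rate D M1 M2 \<le> two_sender_rate_t ?s D M1 M2"
      using ge by (intro two_sender_rate_le) simp
    ultimately show "two_sender_rate D M1 M2 \<le> rate D2 + max (rate D1) (rate D3) + \<epsilon>"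
      using t1 t2 t3 upper[of ?s] by linarith
  qed
  have lower_lim: "rate D1 + rate D2 \<le> two_sender_rate D M1 M2"
    unfolding two_sender_rate_def
  proof (rule cINF_greatest)
    fix s :: nat assume "s \<in> {1..}"
    then have "rate D1 \<le> rate_t s D1" "rate D2 \<le> rate_t s D2" by (auto intro: rate_le)
    then show "rate D1 + rate D2 \<le> two_sender_rate_t s D M1 M2" using lower[of s] by linarith
  qed simp
  \<comment> \<open>If the rate of \<open>D1\<close> is at least that of \<open>D3\<close>, the
    maximum is the rate of \<open>D1\<close> and the upper and lower bounds coincide.\<close>
  show ?thesis using upper[of t] lower[of t] upper_lim lower_lim by (auto simp: max_def)
qed

end
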